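(* If $s_i=i/n$ for all $n\in\mathbb N$ and $i\in\{1,\dots,n\}$, and if $2\le K<+\infty$, then $$\liminf_{n\to\infty}\tau_n^2\ >\ 2\left(\sum_{k=1}^Kw_k\right)^2.$$
   Context: $Z=\{Z(s),s\in[0,1]\}$ is a stationary zero-mean Gaussian process with covariance $\mathrm{cov}\{Z(s),Z(t)\}=\sigma_0^2e^{-\theta_0|s-t|}$, for fixed $\theta_0,\sigma_0^2\in(0,\infty)$. For each $n$, the observation points are $s_1<\dots<s_n$ in $[0,1]$ (with $s_i=s_i^{(n)}$ depending on $n$). $(w_k)_{k\ge1}$ is a fixed sequence of non-negative numbers, not all zero (not depending on $n$), and $K=\max\{k\ge 1: w_k\ne0\}$ (with $K=+\infty$ if infinitely many $w_k$ are non-zero). For $i,k\ge1$ with $i+k\le n$, $$W^2_{i,i+k}=\frac{\{Z(s_{i+k})-e^{-\theta_0(s_{i+k}-s_i)}Z(s_i)\}^2}{\sigma_0^2(1-e^{-2\theta_0(s_{i+k}-s_i)})},\qquad \tau_n^2=\frac1n\,\mathrm{var}\left\{\sum_{i=1}^{n-1}\sum_{k=1}^{\min\{K,n-i\}}w_k\left(W^2_{i,i+k}-1\right)\right\}.$$ *)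

theory Defs
  imports "HOL-Probability.Probability" "HOL-Library.Extended_Nat"
begin

text \<open>Gaussian laws include the Dirac measures (variance zero), which is needed for a
  Gaussian process: e.g. the linear combination with all coefficients zero is constant.\<close>

definition gaussian_rv :: "'a measure \<Rightarrow> ('a \<Rightarrow> real) \<Rightarrow> bool" where
  "gaussian_rv M X \<longleftrightarrow> X \<in> borel_measurable M \<and>
     (\<exists>\<mu> \<sigma>. (\<sigma> > 0 \<and> distributed M lborel X (normal_density \<mu> \<sigma>)) \<or> (AE x in M. X x = \<mu>))"

definition gaussian_process :: "'a measure \<Rightarrow> 'i set \<Rightarrow> ('i \<Rightarrow> 'a \<Rightarrow> real) \<Rightarrow> bool" where
  "gaussian_process M T Z \<longleftrightarrow> prob_space M \<and>
     (\<forall>F c. finite F \<and> F \<subseteq> T \<longrightarrow> gaussian_rv M (\<lambda>x. \<Sum>t\<in>F. c t * Z t x))"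

definition covariance :: "'a measure \<Rightarrow> ('a \<Rightarrow> real) \<Rightarrow> ('a \<Rightarrow> real) \<Rightarrow> real" where
  "covariance M X Y =
     (\<integral>x. (X x - (\<integral>y. X y \<partial>M)) * (Y x - (\<integral>y. Y y \<partial>M)) \<partial>M)"

text \<open>Stationarity is not a separate clause: the law of a Gaussian process is determined by its
  mean and covariance functions, and here the former is zero and the latter depends on
  \<open>\<bar>s - t\<bar>\<close> only.\<close>

definition exp_gaussian_process ::
    "'a measure \<Rightarrow> real \<Rightarrow> real \<Rightarrow> (real \<Rightarrow> 'a \<Rightarrow> real) \<Rightarrow> bool" where
  "exp_gaussian_process M \<theta> \<sigma> Z \<longleftrightarrow> gaussian_process M {0..1} Z \<and>
     (\<forall>s\<in>{0..1}. (\<integral>x. Z s x \<partial>M) = 0) \<and>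
     (\<forall>s\<in>{0..1}. \<forall>t\<in>{0..1}. covariance M (Z s) (Z t) = \<sigma>\<^sup>2 * exp (- \<theta> * \<bar>s - t\<bar>))"

text \<open>The maximal lag \<open>K\<close>: the largest \<open>k \<ge> 1\<close> with \<open>w k \<noteq> 0\<close>, and \<open>\<infinity>\<close> if there are
  infinitely many such \<open>k\<close>. The value \<open>w 0\<close> is never used.\<close>

definition max_lag :: "(nat \<Rightarrow> real) \<Rightarrow> enat" where
  "max_lag w = (SUP k\<in>{k. 1 \<le> k \<and> w k \<noteq> 0}. enat k)"

text \<open>Here \<open>s\<close> is a single row of observation points.\<close>

definition W2 ::
    "real \<Rightarrow> real \<Rightarrow> (real \<Rightarrow> 'a \<Rightarrow> real) \<Rightarrow> (nat \<Rightarrow> real) \<Rightarrow> nat \<Rightarrow> nat \<Rightarrow> 'a \<Rightarrow> real" where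
  "W2 \<theta> \<sigma> Z s i j x =
     (Z (s j) x - exp (- \<theta> * (s j - s i)) * Z (s i) x)\<^sup>2 /
     (\<sigma>\<^sup>2 * (1 - exp (- 2 * \<theta> * (s j - s i))))"

text \<open>Here \<open>s n i\<close> is the \<open>i\<close>-th of \<open>n\<close> observation points.\<close>

definition tau2 ::
    "'a measure \<Rightarrow> real \<Rightarrow> real \<Rightarrow> (real \<Rightarrow> 'a \<Rightarrow> real) \<Rightarrow> (nat \<Rightarrow> nat \<Rightarrow> real) \<Rightarrow>
     (nat \<Rightarrow> real) \<Rightarrow> nat \<Rightarrow> real" where
  "tau2 M \<theta> \<sigma> Z s w n = 1 / real n *
     prob_space.variance M (\<lambda>x.
       \<Sum>i = 1..n - 1. \<Sum>k | 1 \<le> k \<and> enat k \<le> min (max_lag w) (enat (n - i)).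
         w k * (W2 \<theta> \<sigma> Z (s n) i (i + k) x - 1))"

end

theory Submission
  imports Defs "HOL-Real_Asymp.Real_Asymp"
begin

text \<open>On the regular grid put \<open>r = exp (- \<theta> / n)\<close>. The increments \<open>D j = Z (j/n) - r * Z ((j-1)/n)\<close>,
  \<open>2 \<le> j \<le> n\<close>, are uncorrelated with common variance, and
  \<open>Z ((i+k)/n) - r^k * Z (i/n)\<close> is a linear combination of \<open>D (i+1), \<dots>, D (i+k)\<close>. So the weighted
  sum of the \<open>W2\<close> is a quadratic form in uncorrelated Gaussian variables, and if \<open>B\<close> is its matrix
  with respect to the normalised increments, its variance is \<open>2 * (\<Sum>j l. (B j l)\<^sup>2)\<close>.
  The trace of \<open>B\<close> is the sum of all weights, at least \<open>(n - K) * S\<close> with \<open>S = (\<Sum>k = 1..K. w k)\<close>,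
  so by Cauchy-Schwarz the diagonal alone already gives \<open>2 * S\<^sup>2\<close> in the limit. The inequality is
  strict because \<open>K \<ge> 2\<close> makes the entries \<open>B j (j+1)\<close> bounded below by a positive constant.\<close>

section \<open>Moments of a centered Gaussian variable\<close>

text \<open>Expressing the fourth moment through the second lets one identity cover both the density
  case and the almost surely constant case, where centering forces the constant to be 0.\<close>

lemma (in prob_space) gaussian_rv_centered_moments:
  assumes "gaussian_rv M X" and "expectation X = 0"
  shows gaussian_rv_integrable_power: "integrable M (\<lambda>x. X x ^ k)"
    and gaussian_rv_fourth_moment:
      "expectation (\<lambda>x. X x ^ 4) = 3 * (expectation (\<lambda>x. (X x)\<^sup>2))\<^sup>2"
proof -
  have [measurable]: "X \<in> borel_measurable M"
    using assms(1) by (simp add: gaussian_rv_def)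
  consider \<mu> \<sigma> where "\<sigma> > 0" "distributed M lborel X (normal_density \<mu> \<sigma>)"
    | \<mu> where "AE x in M. X x = \<mu>"
    using assms(1) by (auto simp: gaussian_rv_def)
  then have "integrable M (\<lambda>x. X x ^ k) \<and>
    expectation (\<lambda>x. X x ^ 4) = 3 * (expectation (\<lambda>x. (X x)\<^sup>2))\<^sup>2"
  proof cases
    case 1
    have "\<mu> = 0"
      using normal_distributed_expectation[OF 1] assms(2) by simp
    note D = 1(2)[unfolded this]
    have int: "integrable M (\<lambda>x. X x ^ k)"
      using distributed_integrable[OF D, of "\<lambda>x. x ^ k"] integrable_normal_moment[OF 1(1), of 0 k]
      by (simp add: normal_density_nonneg)
    \<comment> \<open>The 3 is \<open>fact 4 / (2 ^ 2 * fact 2)\<close>, from the formula for even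
      normal moments.\<close>
    have "expectation (\<lambda>x. X x ^ 4) = 3 * \<sigma> ^ 4"
      using distributed_integral[OF D, of "\<lambda>x. x ^ 4"] integral_normal_moment_even[of \<sigma> 0 2] 1(1)
      by (simp add: normal_density_nonneg fact_numeral field_simps flip: power_mult)
    moreover have "expectation (\<lambda>x. (X x)\<^sup>2) = \<sigma>\<^sup>2"
      using distributed_integral[OF D, of "\<lambda>x. x\<^sup>2"] integral_normal_moment_even[of \<sigma> 0 1] 1(1)
      by (simp add: normal_density_nonneg fact_numeral)
    ultimately show ?thesis
      using int by (simp flip: power_mult)
  next
    case 2
    have "expectation X = expectation (\<lambda>_. \<mu>)"
      using 2 by (intro integral_cong_AE) auto
    with assms(2) have "\<mu> = 0"
      by (simp add: prob_space)
    with 2 have ae: "AE x in M. X x = 0" by simp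
    \<comment> \<open>The constant is written \<open>0 ^ k\<close> because it is 1 for
      \<open>k = 0\<close>.\<close>
    have "integrable M (\<lambda>x. X x ^ k) \<longleftrightarrow> integrable M (\<lambda>_. 0 ^ k :: real)"
      using ae by (intro integrable_cong_AE) auto
    moreover have "expectation (\<lambda>x. X x ^ j) = expectation (\<lambda>_. 0 ^ j :: real)" for j
      using ae by (intro integral_cong_AE) auto
    ultimately show ?thesis by simp
  qed
  then show "integrable M (\<lambda>x. X x ^ k)"
    "expectation (\<lambda>x. X x ^ 4) = 3 * (expectation (\<lambda>x. (X x)\<^sup>2))\<^sup>2" by auto
qed

section \<open>The linear span of a process\<close>

text \<open>For a Gaussian process every member is a Gaussian variable. Joint Gaussianity enters
  below only through closure of this set under linear operations, so no joint density is
  needed.\<close>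

definition process_span :: "'i set \<Rightarrow> ('i \<Rightarrow> 'a \<Rightarrow> real) \<Rightarrow> ('a \<Rightarrow> real) set" where
  "process_span T Z = {\<lambda>x. \<Sum>t\<in>F. c t * Z t x | F c. finite F \<and> F \<subseteq> T}"

lemma process_span_base: "t \<in> T \<Longrightarrow> Z t \<in> process_span T Z"
  unfolding process_span_def by (intro CollectI exI[of _ "{t}"] exI[of _ "\<lambda>_. 1"]) auto

lemma process_span_scale:
  assumes "X \<in> process_span T Z"
  shows "(\<lambda>x. a * X x) \<in> process_span T Z"
proof -
  from assms obtain F c where F: "finite F" "F \<subseteq> T" and X: "X = (\<lambda>x. \<Sum>t\<in>F. c t * Z t x)"
    unfolding process_span_def by blast
  have "(\<lambda>x. a * X x) = (\<lambda>x. \<Sum>t\<in>F. (a * c t) * Z t x)"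
    by (simp add: X sum_distrib_left mult.assoc)
  with F show ?thesis
    unfolding process_span_def by (intro CollectI exI[of _ F] exI[of _ "\<lambda>t. a * c t"]) simp
qed

lemma process_span_add:
  assumes "X \<in> process_span T Z" and "Y \<in> process_span T Z"
  shows "(\<lambda>x. X x + Y x) \<in> process_span T Z"
proof -
  from assms(1) obtain F c where F: "finite F" "F \<subseteq> T" and X: "X = (\<lambda>x. \<Sum>t\<in>F. c t * Z t x)"
    unfolding process_span_def by blast
  from assms(2) obtain G d where G: "finite G" "G \<subseteq> T" and Y: "Y = (\<lambda>x. \<Sum>t\<in>G. d t * Z t x)"
    unfolding process_span_def by blast
  \<comment> \<open>Both coefficient families are extended by zero, since the two index sets may
    overlap.\<close>
  let ?e = "\<lambda>t. (if t \<in> F then c t else 0) + (if t \<in> G then d t else 0)"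
  have "X x + Y x = (\<Sum>t\<in>F \<union> G. ?e t * Z t x)" for x
  proof -
    have "X x = (\<Sum>t\<in>F \<union> G. (if t \<in> F then c t else 0) * Z t x)"
      unfolding X using F G by (intro sum.mono_neutral_cong_left) auto
    moreover have "Y x = (\<Sum>t\<in>F \<union> G. (if t \<in> G then d t else 0) * Z t x)"
      unfolding Y using F G by (intro sum.mono_neutral_cong_left) auto
    ultimately show ?thesis
      by (simp add: distrib_right sum.distrib)
  qed
  then have "(\<lambda>x. X x + Y x) = (\<lambda>x. \<Sum>t\<in>F \<union> G. ?e t * Z t x)" by blast
  with F G show ?thesis
    unfolding process_span_def by (intro CollectI exI[of _ "F \<union> G"] exI[of _ ?e]) simp
qed

lemma process_span_diff:
  assumes "X \<in> process_span T Z" and "Y \<in> process_span T Z"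
  shows "(\<lambda>x. X x - Y x) \<in> process_span T Z"
  using process_span_add[OF assms(1) process_span_scale[OF assms(2), of "-1"]] by simp

lemma process_span_sum:
  assumes "finite J" and "\<And>j. j \<in> J \<Longrightarrow> D j \<in> process_span T Z"
  shows "(\<lambda>x. \<Sum>j\<in>J. a j * D j x) \<in> process_span T Z"
  using assms
proof (induction J)
  case empty
  show ?case
    unfolding process_span_def by (intro CollectI exI[of _ "{}"]) auto
next
  case (insert j J)
  then show ?case
    by (simp add: process_span_add process_span_scale)
qed

section \<open>Variances of quadratic forms in Gaussian variables\<close>

locale centered_gaussian_process =
  fixes M :: "'a measure" and T :: "'i set" and Z :: "'i \<Rightarrow> 'a \<Rightarrow> real"
  assumes gaussian: "gaussian_process M T Z"
    and centered: "t \<in> T \<Longrightarrow> (\<integral>x. Z t x \<partial>M) = 0"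
begin

sublocale prob_space M
  using gaussian by (simp add: gaussian_process_def)

lemma span_gaussian: "X \<in> process_span T Z \<Longrightarrow> gaussian_rv M X"
  using gaussian by (auto simp: gaussian_process_def process_span_def)

lemma span_centered:
  assumes "X \<in> process_span T Z"
  shows "expectation X = 0"
proof -
  from assms obtain F c where F: "F \<subseteq> T" and X: "X = (\<lambda>x. \<Sum>t\<in>F. c t * Z t x)"
    unfolding process_span_def by blast
  have "integrable M (Z t)" if "t \<in> F" for t
    using gaussian_rv_integrable_power[OF span_gaussian[OF process_span_base] centered, of t 1]
      F that by auto
  then have "expectation X = (\<Sum>t\<in>F. c t * expectation (Z t))"
    unfolding X by (subst Bochner_Integration.integral_sum) auto
  then show ?thesis
    using F centered by (auto intro!: sum.neutral)
qed

lemma span_integrable_power: "X \<in> process_span T Z \<Longrightarrow> integrable M (\<lambda>x. X x ^ k)"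
  by (intro gaussian_rv_integrable_power span_gaussian span_centered)

lemma span_fourth_moment:
  "X \<in> process_span T Z \<Longrightarrow> expectation (\<lambda>x. X x ^ 4) = 3 * (expectation (\<lambda>x. (X x)\<^sup>2))\<^sup>2"
  by (intro gaussian_rv_fourth_moment span_gaussian span_centered)

text \<open>Polarization: the product is half of the square of the sum minus both squares, and all
  three squares are integrable.\<close>

lemma span_integrable_mult:
  assumes X: "X \<in> process_span T Z" and Y: "Y \<in> process_span T Z"
  shows "integrable M (\<lambda>x. X x * Y x)"
proof -
  have "integrable M (\<lambda>x. ((X x + Y x)\<^sup>2 - (X x)\<^sup>2 - (Y x)\<^sup>2) / 2)"
    using span_integrable_power[of _ 2] process_span_add[OF X Y] X Y
    by (intro Bochner_Integration.integrable_diff integrable_divide) auto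
  then show ?thesis
    by (simp add: power2_eq_square algebra_simps)
qed

text \<open>A case of Isserlis' theorem. The term
  \<open>2 * (expectation (\<lambda>x. X x * Y x))\<^sup>2\<close> is exactly the covariance of the
  two squares.\<close>

lemma span_sq_mult_sq:
  assumes X: "X \<in> process_span T Z" and Y: "Y \<in> process_span T Z"
  shows span_integrable_sq_mult_sq: "integrable M (\<lambda>x. (X x)\<^sup>2 * (Y x)\<^sup>2)" (is ?int)
    and span_isserlis: "expectation (\<lambda>x. (X x)\<^sup>2 * (Y x)\<^sup>2) =
      expectation (\<lambda>x. (X x)\<^sup>2) * expectation (\<lambda>x. (Y x)\<^sup>2) +
      2 * (expectation (\<lambda>x. X x * Y x))\<^sup>2" (is ?eq)
proof -
  note XY = X Y process_span_add[OF X Y] process_span_diff[OF X Y]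
  note int4 = XY[THEN span_integrable_power, where k = 4]
  note int2 = XY(1,2)[THEN span_integrable_power, where k = 2]
  note int = int2 span_integrable_mult[OF X Y]
  let ?A = "expectation (\<lambda>x. (X x)\<^sup>2)" and ?B = "expectation (\<lambda>x. (Y x)\<^sup>2)"
    and ?C = "expectation (\<lambda>x. X x * Y x)"
  \<comment> \<open>Polarization reduces the mixed moment to fourth moments of single Gaussian variables.\<close>
  have *: "(\<lambda>x. (X x)\<^sup>2 * (Y x)\<^sup>2) =
    (\<lambda>x. ((X x + Y x) ^ 4 + (X x - Y x) ^ 4 - 2 * X x ^ 4 - 2 * Y x ^ 4) / 12)"
    by (rule ext, simp, algebra)
  show ?int
    unfolding * using int4 by (intro Bochner_Integration.integrable_diff
        Bochner_Integration.integrable_add integrable_divide integrable_mult_right) auto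
  have add: "expectation (\<lambda>x. (X x + Y x)\<^sup>2) = ?A + ?B + 2 * ?C"
    using int by (simp add: power2_sum mult.assoc)
  have diff: "expectation (\<lambda>x. (X x - Y x)\<^sup>2) = ?A + ?B - 2 * ?C"
    using int by (simp add: power2_diff mult.assoc)
  have "expectation (\<lambda>x. (X x)\<^sup>2 * (Y x)\<^sup>2) = (expectation (\<lambda>x. (X x + Y x) ^ 4) +
      expectation (\<lambda>x. (X x - Y x) ^ 4) - 2 * expectation (\<lambda>x. X x ^ 4)
      - 2 * expectation (\<lambda>x. Y x ^ 4)) / 12"
    unfolding * using int4 by simp
  \<comment> \<open>After the fourth moments are replaced, the numerator is
    \<open>3 * (4 * ?A * ?B + 8 * ?C\<^sup>2)\<close>.\<close>
  also have "\<dots> = ?A * ?B + 2 * ?C\<^sup>2"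
    unfolding XY[THEN span_fourth_moment] add diff by (simp add: power2_eq_square algebra_simps)
  finally show ?eq .
qed

text \<open>Bilinearity of the covariance, together with Isserlis' formula for the covariance of
  \<open>(Y i)\<^sup>2\<close> and \<open>(Y j)\<^sup>2\<close>.\<close>

lemma variance_sum_squares:
  assumes "finite I" and Y: "\<And>i. i \<in> I \<Longrightarrow> Y i \<in> process_span T Z"
  shows "variance (\<lambda>x. \<Sum>i\<in>I. u i * (Y i x)\<^sup>2) =
    2 * (\<Sum>i\<in>I. \<Sum>j\<in>I. u i * u j * (expectation (\<lambda>x. Y i x * Y j x))\<^sup>2)"
proof -
  let ?S = "\<lambda>x. \<Sum>i\<in>I. u i * (Y i x)\<^sup>2"
  note int = span_integrable_power[OF Y, of _ 2] span_integrable_sq_mult_sq[OF Y Y]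
  have sq: "(?S x)\<^sup>2 = (\<Sum>i\<in>I. \<Sum>j\<in>I. u i * u j * ((Y i x)\<^sup>2 * (Y j x)\<^sup>2))" for x
    by (simp add: power2_eq_square sum_product algebra_simps)
  have "integrable M ?S" "integrable M (\<lambda>x. (?S x)\<^sup>2)"
    unfolding sq using int by auto
  then have "variance ?S = expectation (\<lambda>x. (?S x)\<^sup>2) - (expectation ?S)\<^sup>2"
    by (rule variance_eq)
  also have "\<dots> = expectation (\<lambda>x. (?S x)\<^sup>2) -
      (\<Sum>i\<in>I. u i * expectation (\<lambda>x. (Y i x)\<^sup>2))\<^sup>2"
    using int by simp
  also have "expectation (\<lambda>x. (?S x)\<^sup>2) =
    (\<Sum>i\<in>I. \<Sum>j\<in>I. u i * u j * expectation (\<lambda>x. (Y i x)\<^sup>2 * (Y j x)\<^sup>2))"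
    unfolding sq using int by (simp add: Bochner_Integration.integral_sum)
  also have "\<dots> - (\<Sum>i\<in>I. u i * expectation (\<lambda>x. (Y i x)\<^sup>2))\<^sup>2 =
    (\<Sum>i\<in>I. \<Sum>j\<in>I. u i * u j * (expectation (\<lambda>x. (Y i x)\<^sup>2 * (Y j x)\<^sup>2) -
       expectation (\<lambda>x. (Y i x)\<^sup>2) * expectation (\<lambda>x. (Y j x)\<^sup>2)))"
    by (simp add: power2_eq_square sum_product right_diff_distrib sum_subtractf algebra_simps)
  also have "\<dots> = 2 * (\<Sum>i\<in>I. \<Sum>j\<in>I. u i * u j * (expectation (\<lambda>x. Y i x * Y j x))\<^sup>2)"
    by (simp add: span_isserlis[OF Y Y] sum_distrib_left algebra_simps)
  finally show ?thesis .
qed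

text \<open>The double sum on the right is the squared Frobenius norm of the matrix of the form. The
  linear forms have covariances \<open>v * (\<Sum>k\<in>J. \<alpha> i k * \<alpha> j k)\<close>;
  expanding the squares of these and exchanging sums regroups the fourfold sum into that
  norm.\<close>

lemma variance_quadratic_form:
  assumes "finite I" "finite J" and D: "\<And>j. j \<in> J \<Longrightarrow> D j \<in> process_span T Z"
    and orth: "\<And>i j. i \<in> J \<Longrightarrow> j \<in> J \<Longrightarrow>
      expectation (\<lambda>x. D i x * D j x) = (if i = j then v else 0)"
  shows "variance (\<lambda>x. \<Sum>i\<in>I. u i * (\<Sum>j\<in>J. \<alpha> i j * D j x)\<^sup>2) =
    2 * v\<^sup>2 * (\<Sum>j\<in>J. \<Sum>k\<in>J. (\<Sum>i\<in>I. u i * \<alpha> i j * \<alpha> i k)\<^sup>2)"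
proof -
  have cov: "expectation (\<lambda>x. (\<Sum>k\<in>J. \<alpha> i k * D k x) * (\<Sum>k\<in>J. \<alpha> j k * D k x)) =
    v * (\<Sum>k\<in>J. \<alpha> i k * \<alpha> j k)" for i j
  proof -
    have "(\<Sum>k\<in>J. \<alpha> i k * D k x) * (\<Sum>k\<in>J. \<alpha> j k * D k x) =
      (\<Sum>k\<in>J. \<Sum>l\<in>J. \<alpha> i k * \<alpha> j l * (D k x * D l x))" for x
      by (simp add: sum_product algebra_simps)
    then have "expectation (\<lambda>x. (\<Sum>k\<in>J. \<alpha> i k * D k x) * (\<Sum>k\<in>J. \<alpha> j k * D k x)) =
      (\<Sum>k\<in>J. \<Sum>l\<in>J. \<alpha> i k * \<alpha> j l * expectation (\<lambda>x. D k x * D l x))"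
      using span_integrable_mult[OF D D] by (simp add: Bochner_Integration.integral_sum)
    also have "\<dots> = (\<Sum>k\<in>J. \<Sum>l\<in>J. if k = l then \<alpha> i k * \<alpha> j l * v else 0)"
      by (intro sum.cong refl) (auto simp: orth)
    also have "\<dots> = v * (\<Sum>k\<in>J. \<alpha> i k * \<alpha> j k)"
      using assms(2) by (simp add: sum_distrib_left algebra_simps)
    finally show ?thesis .
  qed
  have "(\<Sum>i\<in>I. \<Sum>j\<in>I. u i * u j * (\<Sum>k\<in>J. \<alpha> i k * \<alpha> j k)\<^sup>2) =
    (\<Sum>i\<in>I. \<Sum>j\<in>I. \<Sum>k\<in>J. \<Sum>l\<in>J. (u i * \<alpha> i k * \<alpha> i l) * (u j * \<alpha> j k * \<alpha> j l))"
    by (simp add: power2_eq_square sum_product sum_distrib_left algebra_simps)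
  also have "\<dots> = (\<Sum>i\<in>I. \<Sum>k\<in>J. \<Sum>l\<in>J. \<Sum>j\<in>I. (u i * \<alpha> i k * \<alpha> i l) * (u j * \<alpha> j k * \<alpha> j l))"
    by (subst (2) sum.swap, subst (3) sum.swap) simp
  also have "\<dots> = (\<Sum>k\<in>J. \<Sum>l\<in>J. \<Sum>i\<in>I. \<Sum>j\<in>I. (u i * \<alpha> i k * \<alpha> i l) * (u j * \<alpha> j k * \<alpha> j l))"
    by (subst sum.swap, subst (2) sum.swap) simp
  finally have swap: "(\<Sum>i\<in>I. \<Sum>j\<in>I. u i * u j * (\<Sum>k\<in>J. \<alpha> i k * \<alpha> j k)\<^sup>2) =
    (\<Sum>k\<in>J. \<Sum>l\<in>J. (\<Sum>i\<in>I. u i * \<alpha> i k * \<alpha> i l)\<^sup>2)"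
    by (simp add: power2_eq_square sum_product)
  have "variance (\<lambda>x. \<Sum>i\<in>I. u i * (\<Sum>j\<in>J. \<alpha> i j * D j x)\<^sup>2) =
    2 * (\<Sum>i\<in>I. \<Sum>j\<in>I. u i * u j * (v * (\<Sum>k\<in>J. \<alpha> i k * \<alpha> j k))\<^sup>2)"
    using assms(1,2) D by (subst variance_sum_squares) (auto simp: cov intro: process_span_sum)
  also have "\<dots> = 2 * v\<^sup>2 * (\<Sum>i\<in>I. \<Sum>j\<in>I. u i * u j * (\<Sum>k\<in>J. \<alpha> i k * \<alpha> j k)\<^sup>2)"
    unfolding power_mult_distrib by (simp add: sum_distrib_left mult_ac)
  finally show ?thesis
    unfolding swap .
qed

text \<open>This removes the \<open>- 1\<close> of every summand in \<open>tau2\<close>: together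
  they amount to subtracting the total weight, a constant.\<close>

lemma variance_quadratic_form_shift:
  assumes "finite I" "finite J" and D: "\<And>j. j \<in> J \<Longrightarrow> D j \<in> process_span T Z"
  shows "variance (\<lambda>x. (\<Sum>i\<in>I. u i * (\<Sum>j\<in>J. \<alpha> i j * D j x)\<^sup>2) - c) =
    variance (\<lambda>x. \<Sum>i\<in>I. u i * (\<Sum>j\<in>J. \<alpha> i j * D j x)\<^sup>2)"
proof -
  have "integrable M (\<lambda>x. (\<Sum>j\<in>J. \<alpha> i j * D j x)\<^sup>2)" for i
    using span_integrable_power[OF process_span_sum[OF assms(2) D], where k = 2] by auto
  then show ?thesis
    by (simp add: prob_space)
qed

end

section \<open>Increments on the regular grid\<close>

lemma exp_gaussian_process_imp_centered:
  "exp_gaussian_process M \<theta> \<sigma> Z \<Longrightarrow> centered_gaussian_process M {0..1} Z"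
  by (auto simp: exp_gaussian_process_def centered_gaussian_process_def)

text \<open>On the grid the covariance at \<open>d\<close> steps is
  \<open>\<sigma>\<^sup>2 * r ^ d\<close>, that of an AR(1) sequence, and \<open>D\<close> is its
  innovation sequence. At lag \<open>d > 0\<close> the four terms of the product have coefficients
  \<open>r ^ d\<close>, \<open>- r ^ d\<close>, \<open>- r ^ (d + 2)\<close> and
  \<open>r ^ (d + 2)\<close>, which cancel.\<close>

lemma exp_gaussian_process_increments_orthogonal:
  fixes n i j :: nat
  assumes Z: "exp_gaussian_process M \<theta> \<sigma> Z" and ij: "i \<in> {2..n}" "j \<in> {2..n}"
    and r_def: "r = exp (- \<theta> / real n)"
  defines "D \<equiv> \<lambda>j x. Z (real j / real n) x - r * Z (real (j - 1) / real n) x"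
  shows "(\<integral>x. D i x * D j x \<partial>M) = (if i = j then \<sigma>\<^sup>2 * (1 - r\<^sup>2) else 0)"
proof -
  interpret centered_gaussian_process M "{0..1}" Z
    by (rule exp_gaussian_process_imp_centered[OF Z])
  have grid: "real i / real n \<in> {0..1}" if "i \<le> n" for i
    using that by (cases "n = 0") auto
  note int = span_integrable_mult[OF process_span_base[OF grid] process_span_base[OF grid]]
  have cov: "expectation (\<lambda>x. Z (real i / real n) x * Z (real (i + d) / real n) x) = \<sigma>\<^sup>2 * r ^ d"
    if "i + d \<le> n" for i d
  proof -
    have g: "real i / real n \<in> {0..1}" "real (i + d) / real n \<in> {0..1}"
      using grid[of i] grid[of "i + d"] that by simp_all
    then have "covariance M (Z (real i / real n)) (Z (real (i + d) / real n)) =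
        \<sigma>\<^sup>2 * exp (- \<theta> * \<bar>real i / real n - real (i + d) / real n\<bar>)"
      using Z unfolding exp_gaussian_process_def by blast
    also have "\<bar>real i / real n - real (i + d) / real n\<bar> = real d / real n"
      by (simp add: field_simps flip: diff_divide_distrib)
    also have "exp (- \<theta> * (real d / real n)) = r ^ d"
      by (simp add: r_def flip: exp_of_nat_mult)
    finally show ?thesis
      using centered g by (simp add: covariance_def)
  qed
  have *: "expectation (\<lambda>x. D i x * D (i + d) x) = (if d = 0 then \<sigma>\<^sup>2 * (1 - r\<^sup>2) else 0)"
    if i: "i \<ge> 2" "i + d \<le> n" for i d
  proof -
    have "expectation (\<lambda>x. D i x * D (i + d) x) =
      expectation (\<lambda>x. Z (real i / real n) x * Z (real (i + d) / real n) x)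
      - r * expectation (\<lambda>x. Z (real i / real n) x * Z (real (i + d - 1) / real n) x)
      - r * expectation (\<lambda>x. Z (real (i - 1) / real n) x * Z (real (i + d) / real n) x)
      + r\<^sup>2 * expectation (\<lambda>x. Z (real (i - 1) / real n) x * Z (real (i + d - 1) / real n) x)"
    proof -
      have "(\<lambda>x. D i x * D (i + d) x) = (\<lambda>x.
        Z (real i / real n) x * Z (real (i + d) / real n) x
        - r * (Z (real i / real n) x * Z (real (i + d - 1) / real n) x)
        - r * (Z (real (i - 1) / real n) x * Z (real (i + d) / real n) x)
        + r\<^sup>2 * (Z (real (i - 1) / real n) x * Z (real (i + d - 1) / real n) x))"
        unfolding D_def by (simp add: power2_eq_square algebra_simps)
      moreover have "i \<le> n" "i - 1 \<le> n" "i + d \<le> n" "i + d - 1 \<le> n"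
        using i by auto
      ultimately show ?thesis
        using int by (simp del: of_nat_add of_nat_diff)
    qed
    also have "\<dots> = (if d = 0 then \<sigma>\<^sup>2 * (1 - r\<^sup>2) else 0)"
    \<comment> \<open>Lag zero is separate because \<open>i + d - 1\<close> then lies to the left of
      \<open>i\<close>, so the two factors must be swapped before \<open>cov\<close>
      applies.\<close>
    proof (cases d)
      case 0
      have "expectation (\<lambda>x. Z (real i / real n) x * Z (real (i - 1) / real n) x) = \<sigma>\<^sup>2 * r"
        "expectation (\<lambda>x. Z (real (i - 1) / real n) x * Z (real i / real n) x) = \<sigma>\<^sup>2 * r"
        using cov[of "i - 1" 1] i by (simp_all add: mult.commute)
      then show ?thesis
        using cov[of i 0] cov[of "i - 1" 0] i 0 by (simp add: power2_eq_square algebra_simps)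
    next
      case (Suc e)
      have "i - 1 + Suc (Suc e) = i + d" "i + e = i + d - 1" "i - 1 + d = i + d - 1"
        using i Suc by auto
      then show ?thesis
        using cov[of i d] cov[of i e] cov[of "i - 1" "Suc (Suc e)"] cov[of "i - 1" d] i Suc
        by (simp add: power2_eq_square algebra_simps del: of_nat_add of_nat_diff)
    qed
    finally show ?thesis .
  qed
  show ?thesis
  proof (cases "i \<le> j")
    case True
    then show ?thesis
      using *[of i "j - i"] ij by auto
  next
    case False
    then show ?thesis
      using *[of j "i - j"] ij by (auto simp: mult.commute)
  qed
qed

text \<open>The weighted sum telescopes. It is used twice: with \<open>a\<close> a path of the
  process on the grid, to write prediction errors in increments, and with \<open>a\<close>
  constantly 1, as a geometric sum.\<close>

lemma sum_ar1_increments: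
  fixes a :: "nat \<Rightarrow> 'b::comm_ring_1"
  shows "(\<Sum>j\<in>{i<..i + k}. r ^ (i + k - j) * (a j - r * a (j - 1))) = a (i + k) - r ^ k * a i"
proof (induction k)
  case (Suc k)
  have *: "(\<Sum>j\<in>{i<..i + k}. r ^ (i + Suc k - j) * (a j - r * a (j - 1))) =
    r * (\<Sum>j\<in>{i<..i + k}. r ^ (i + k - j) * (a j - r * a (j - 1)))"
    unfolding sum_distrib_left by (intro sum.cong refl) (auto simp: Suc_diff_le mult.assoc)
  have "{i<..i + Suc k} = insert (i + Suc k) {i<..i + k}"
    by auto
  then have "(\<Sum>j\<in>{i<..i + Suc k}. r ^ (i + Suc k - j) * (a j - r * a (j - 1))) =
    a (i + Suc k) - r * a (i + k) +
      (\<Sum>j\<in>{i<..i + k}. r ^ (i + Suc k - j) * (a j - r * a (j - 1)))"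
    by simp
  then show ?case
    unfolding * Suc.IH by (simp add: algebra_simps)
qed simp

section \<open>The matrix of the quadratic form and its Frobenius norm\<close>

text \<open>Flattening the nested sums of \<open>tau2\<close> gives the single index set
  \<open>I\<close> required by \<open>variance_quadratic_form\<close>.\<close>

definition lag_pairs :: "nat \<Rightarrow> nat \<Rightarrow> (nat \<times> nat) set" where
  "lag_pairs n K = (SIGMA i:{1..n - 1}. {1..min K (n - i)})"

text \<open>The coefficient of the \<open>j\<close>-th increment in the prediction error of lag \<open>k\<close> from \<open>i\<close>,
  for a pair \<open>a = (i, k)\<close>.\<close>

definition ar1_coeff :: "real \<Rightarrow> nat \<times> nat \<Rightarrow> nat \<Rightarrow> real" where
  "ar1_coeff r a j = (if fst a < j \<and> j \<le> fst a + snd a then r ^ (fst a + snd a - j) else 0)"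

text \<open>The matrix \<open>B\<close>; the factor \<open>(1 - r\<^sup>2) / (1 - r ^ (2 * k))\<close> is the variance ratio of
  increments and lag-\<open>k\<close> prediction errors.\<close>

definition ar1_matrix :: "nat \<Rightarrow> nat \<Rightarrow> real \<Rightarrow> (nat \<Rightarrow> real) \<Rightarrow> nat \<Rightarrow> nat \<Rightarrow> real" where
  "ar1_matrix n K r w j l = (\<Sum>a\<in>lag_pairs n K.
     w (snd a) * (1 - r\<^sup>2) / (1 - r ^ (2 * snd a)) * ar1_coeff r a j * ar1_coeff r a l)"

lemma finite_lag_pairs [simp]: "finite (lag_pairs n K)"
  by (simp add: lag_pairs_def)

lemma mem_lag_pairs:
  "(i, k) \<in> lag_pairs n K \<longleftrightarrow> 1 \<le> i \<and> 1 \<le> k \<and> k \<le> K \<and> i + k \<le> n"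
  by (auto simp: lag_pairs_def)

lemma sum_ar1_coeff:
  assumes "(i, k) \<in> lag_pairs n K"
  shows "(\<Sum>j = 2..n. ar1_coeff r (i, k) j * f j) = (\<Sum>j\<in>{i<..i + k}. r ^ (i + k - j) * f j)"
  using assms by (intro sum.mono_neutral_cong_right) (auto simp: ar1_coeff_def mem_lag_pairs)

text \<open>Each pair contributes a rank-one matrix, whose trace is its weight: the geometric sum of
  the squared coefficients cancels the normalising ratio. In probabilistic terms, each
  \<open>W2\<close> has mean 1.\<close>

lemma trace_ar1_matrix:
  assumes "0 < r" "r < 1"
  shows "(\<Sum>j = 2..n. ar1_matrix n K r w j j) = (\<Sum>a\<in>lag_pairs n K. w (snd a))"
proof -
  have "(\<Sum>j = 2..n. ar1_matrix n K r w j j) = (\<Sum>a\<in>lag_pairs n K.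
    w (snd a) * (1 - r\<^sup>2) / (1 - r ^ (2 * snd a)) * (\<Sum>j = 2..n. ar1_coeff r a j * ar1_coeff r a j))"
    unfolding ar1_matrix_def sum_distrib_left by (subst sum.swap) (simp add: mult.assoc)
  also have "\<dots> = (\<Sum>a\<in>lag_pairs n K. w (snd a))"
  proof (intro sum.cong refl)
    fix a assume a: "a \<in> lag_pairs n K"
    obtain i k where [simp]: "a = (i, k)" by force
    have "k \<ge> 1" using a by (simp add: mem_lag_pairs)
    then have "r ^ (2 * k) < 1"
      using assms by (intro power_less_one_iff[THEN iffD2]) auto
    have "(1 - r\<^sup>2) * (\<Sum>j = 2..n. ar1_coeff r a j * ar1_coeff r a j) =
      (1 - r\<^sup>2) * (\<Sum>j\<in>{i<..i + k}. (r\<^sup>2) ^ (i + k - j))"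
      using sum_ar1_coeff[of i k n K r "ar1_coeff r a"] a
      by (auto intro!: sum.cong simp: ar1_coeff_def power2_eq_square power_mult_distrib)
    also have "\<dots> = 1 - r ^ (2 * k)"
      using sum_ar1_increments[where r = "r\<^sup>2" and a = "\<lambda>_. 1" and i = i and k = k]
      by (simp add: sum_distrib_left mult.commute flip: power_mult)
    finally have *: "(1 - r\<^sup>2) * (\<Sum>j = 2..n. ar1_coeff r a j * ar1_coeff r a j) = 1 - r ^ (2 * k)" .
    have "w (snd a) * (1 - r\<^sup>2) / (1 - r ^ (2 * snd a)) *
        (\<Sum>j = 2..n. ar1_coeff r a j * ar1_coeff r a j) =
      w k * ((1 - r\<^sup>2) * (\<Sum>j = 2..n. ar1_coeff r a j * ar1_coeff r a j)) / (1 - r ^ (2 * k))"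
      by simp
    then show "w (snd a) * (1 - r\<^sup>2) / (1 - r ^ (2 * snd a)) *
        (\<Sum>j = 2..n. ar1_coeff r a j * ar1_coeff r a j) = w (snd a)"
      unfolding * using \<open>r ^ (2 * k) < 1\<close> by simp
  qed
  finally show ?thesis .
qed

text \<open>All summands are nonnegative, so one may be kept alone: the pair
  \<open>(j - 1, K)\<close>, whose increments \<open>j, ..., j + K - 1\<close> include both
  \<open>j\<close> and \<open>Suc j\<close> as \<open>K \<ge> 2\<close>.\<close>

lemma ar1_matrix_superdiagonal:
  assumes r: "0 < r" "r < 1" and w: "\<And>k. k \<ge> 1 \<Longrightarrow> w k \<ge> 0" and K: "K \<ge> 2"
    and j: "2 \<le> j" "j + K \<le> n + 1"
  shows "ar1_matrix n K r w j (Suc j) \<ge> w K / K * r ^ (2 * n)"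
proof -
  let ?g = "\<lambda>a. w (snd a) * (1 - r\<^sup>2) / (1 - r ^ (2 * snd a)) * ar1_coeff r a j * ar1_coeff r a (Suc j)"
  have a: "(j - 1, K) \<in> lag_pairs n K"
    using K j by (auto simp: mem_lag_pairs)
  have r2: "r\<^sup>2 < 1" and r2K: "r ^ (2 * K) < 1"
    using r K by (auto intro!: power_less_one_iff[THEN iffD2])
  \<comment> \<open>Bernoulli's inequality at \<open>r\<^sup>2 - 1\<close> bounds the normalising
    ratio below by \<open>1 / K\<close> uniformly in \<open>r\<close>, which matters because
    \<open>r\<close> tends to 1 with \<open>n\<close>.\<close>
  have "1 + real K * (r\<^sup>2 - 1) \<le> (1 + (r\<^sup>2 - 1)) ^ K"
    by (rule Bernoulli_inequality) simp
  then have "1 - r ^ (2 * K) \<le> K * (1 - r\<^sup>2)"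
    by (simp add: algebra_simps flip: power_mult)
  then have 1: "(1 - r\<^sup>2) / (1 - r ^ (2 * K)) \<ge> 1 / K"
    using r2K K by (simp add: field_simps)
  \<comment> \<open>The exponent \<open>2 * n\<close> is generous, but \<open>r ^ (2 * n)\<close>
    does not depend on \<open>n\<close> once \<open>r = exp (- \<theta> / n)\<close>.\<close>
  have "r ^ (2 * n) \<le> r ^ ((K - 1) + (K - 2))"
    using r K j by (intro power_decreasing) auto
  also have "\<dots> = ar1_coeff r (j - 1, K) j * ar1_coeff r (j - 1, K) (Suc j)"
    using K j unfolding power_add by (auto simp: ar1_coeff_def)
  finally have 2: "r ^ (2 * n) \<le> \<dots>" .
  have "w K / K * r ^ (2 * n) = w K * ((1 / K) * r ^ (2 * n))"
    by simp
  also have "\<dots> \<le> w K * ((1 - r\<^sup>2) / (1 - r ^ (2 * K)) *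
      (ar1_coeff r (j - 1, K) j * ar1_coeff r (j - 1, K) (Suc j)))"
    using w[of K] K r r2 r2K by (intro mult_left_mono mult_mono 1 2) auto
  also have "\<dots> = ?g (j - 1, K)"
    by simp
  also have "\<dots> \<le> (\<Sum>a\<in>lag_pairs n K. ?g a)"
  proof (rule member_le_sum[OF a])
    fix a assume "a \<in> lag_pairs n K - {(j - 1, K)}"
    then have "snd a \<ge> 1" by (cases a) (auto simp: mem_lag_pairs)
    moreover have "r ^ (2 * snd a) \<le> 1"
      using r by (intro power_le_one) auto
    ultimately show "0 \<le> ?g a"
      using r r2 w by (auto intro!: mult_nonneg_nonneg divide_nonneg_nonneg simp: ar1_coeff_def)
  qed simp
  finally show ?thesis
    by (simp add: ar1_matrix_def)
qed

lemma ar1_matrix_frobenius_lower_bound: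
  assumes r: "0 < r" "r < 1" and w: "\<And>k. k \<ge> 1 \<Longrightarrow> w k \<ge> 0" and K: "K \<ge> 2" "K < n"
  shows "(\<Sum>j = 2..n. \<Sum>l = 2..n. (ar1_matrix n K r w j l)\<^sup>2) \<ge>
    (real (n - K) * (\<Sum>k = 1..K. w k))\<^sup>2 / real (n - 1) +
    real (n - K) * (w K / K * r ^ (2 * n))\<^sup>2"
proof -
  let ?B = "ar1_matrix n K r w" and ?c = "w K / K * r ^ (2 * n)"
  have c: "?c \<ge> 0"
    using r w[of K] K by auto
  \<comment> \<open>The starting points \<open>i \<le> n - K\<close> are those for which all
    \<open>K\<close> lags fit.\<close>
  have "real (n - K) * (\<Sum>k = 1..K. w k) = (\<Sum>a\<in>{1..n - K} \<times> {1..K}. w (snd a))"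
    by (simp add: sum.cartesian_product' flip: sum.cartesian_product)
  also have "\<dots> \<le> (\<Sum>a\<in>lag_pairs n K. w (snd a))"
    using K by (intro sum_mono2) (auto simp: mem_lag_pairs intro!: w)
  finally have trace: "real (n - K) * (\<Sum>k = 1..K. w k) \<le> (\<Sum>j = 2..n. ?B j j)"
    using trace_ar1_matrix[OF r] by simp
  have "(real (n - K) * (\<Sum>k = 1..K. w k))\<^sup>2 \<le> (\<Sum>j = 2..n. ?B j j)\<^sup>2"
    using trace w by (intro power_mono) (auto intro!: mult_nonneg_nonneg sum_nonneg)
  also have "\<dots> \<le> (\<Sum>j = 2..n. (?B j j)\<^sup>2) * real (n - 1)"
    using sum_squared_le_sum_of_squares[of "\<lambda>j. ?B j j" "{2..n}"] by simp
  finally have diag: "(real (n - K) * (\<Sum>k = 1..K. w k))\<^sup>2 / real (n - 1) \<le>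
      (\<Sum>j = 2..n. (?B j j)\<^sup>2)"
    using K by (simp add: field_simps)
  \<comment> \<open>The rows with a bounded superdiagonal entry are
    \<open>2, ..., n + 1 - K\<close>, so there are \<open>n - K\<close> of them.\<close>
  have "real (n - K) * ?c\<^sup>2 = (\<Sum>j = 2..n. if j + K \<le> n + 1 then ?c\<^sup>2 else 0)"
  proof -
    have "(\<Sum>j = 2..n. if j + K \<le> n + 1 then ?c\<^sup>2 else 0) = (\<Sum>j = 2..n + 1 - K. ?c\<^sup>2)"
      using K by (intro sum.mono_neutral_cong_right) auto
    then show ?thesis
      using K by (simp add: Suc_diff_le)
  qed
  with diag have "(real (n - K) * (\<Sum>k = 1..K. w k))\<^sup>2 / real (n - 1) + real (n - K) * ?c\<^sup>2 \<le>
      (\<Sum>j = 2..n. (?B j j)\<^sup>2 + (if j + K \<le> n + 1 then ?c\<^sup>2 else 0))"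
    by (simp add: sum.distrib)
  also have "\<dots> \<le> (\<Sum>j = 2..n. \<Sum>l = 2..n. (?B j l)\<^sup>2)"
  proof (rule sum_mono)
    fix j assume j: "j \<in> {2..n}"
    show "(?B j j)\<^sup>2 + (if j + K \<le> n + 1 then ?c\<^sup>2 else 0) \<le> (\<Sum>l = 2..n. (?B j l)\<^sup>2)"
    proof (cases "j + K \<le> n + 1")
      case True
      then have "?c\<^sup>2 \<le> (?B j (Suc j))\<^sup>2"
        using ar1_matrix_superdiagonal[OF r, where w = w and K = K and j = j and n = n] w K j c
        by (intro power_mono) auto
      then have "(?B j j)\<^sup>2 + ?c\<^sup>2 \<le> (\<Sum>l\<in>{j, Suc j}. (?B j l)\<^sup>2)"
        by simp
      \<comment> \<open>\<open>Suc j\<close> is a valid column: \<open>j + K \<le> n + 1\<close> and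
        \<open>K \<ge> 2\<close> give \<open>Suc j \<le> n\<close>.\<close>
      also have "\<dots> \<le> (\<Sum>l = 2..n. (?B j l)\<^sup>2)"
        using j True K by (intro sum_mono2) auto
      finally show ?thesis
        using True by simp
    next
      case False
      then show ?thesis
        using j by (auto intro!: member_le_sum[of j _ "\<lambda>l. (?B j l)\<^sup>2"])
    qed
  qed
  finally show ?thesis .
qed

section \<open>The variance as a Frobenius norm\<close>

lemma tau2_regular_grid:
  fixes n K :: nat
  assumes Z: "exp_gaussian_process M \<theta> \<sigma> Z" and \<theta>: "\<theta> > 0" and \<sigma>: "\<sigma>\<^sup>2 > 0"
    and s: "\<And>i. i \<in> {1..n} \<Longrightarrow> s n i = real i / real n"
    and K: "max_lag w = enat K" and n: "n > 0"
  shows "tau2 M \<theta> \<sigma> Z s w n =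
    2 / real n * (\<Sum>j = 2..n. \<Sum>l = 2..n. (ar1_matrix n K (exp (- \<theta> / real n)) w j l)\<^sup>2)"
proof -
  interpret centered_gaussian_process M "{0..1}" Z
    by (rule exp_gaussian_process_imp_centered[OF Z])
  define r where "r = exp (- \<theta> / real n)"
  have r: "0 < r" "r < 1"
    using \<theta> n by (auto simp: r_def)
  define D where "D = (\<lambda>j x. Z (real j / real n) x - r * Z (real (j - 1) / real n) x)"
  \<comment> \<open>The weight divided by the denominator of \<open>W2\<close> at lag
    \<open>k\<close>, since \<open>exp (- 2 * \<theta> * k / n) = r ^ (2 * k)\<close>.\<close>
  define u where "u = (\<lambda>a :: nat \<times> nat. w (snd a) / (\<sigma>\<^sup>2 * (1 - r ^ (2 * snd a))))"
  let ?P = "lag_pairs n K"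
  have D_span: "D j \<in> process_span {0..1} Z" if "j \<in> {2..n}" for j
    unfolding D_def using that
    by (intro process_span_diff process_span_scale process_span_base) auto
  have exp_r: "exp (- \<theta> * (real k / real n)) = r ^ k" for k
    by (simp add: r_def flip: exp_of_nat_mult)
  have W2: "w k * (W2 \<theta> \<sigma> Z (s n) i (i + k) x - 1) =
      u (i, k) * (\<Sum>j = 2..n. ar1_coeff r (i, k) j * D j x)\<^sup>2 - w k"
    if "(i, k) \<in> ?P" for i k x
  proof -
    have "s n i = real i / real n" "s n (i + k) = real (i + k) / real n"
      using that s by (auto simp: mem_lag_pairs)
    then have s': "s n (i + k) - s n i = real k / real n"
      by (simp add: field_simps flip: diff_divide_distrib)
    have "(\<Sum>j = 2..n. ar1_coeff r (i, k) j * D j x) =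
        Z (s n (i + k)) x - r ^ k * Z (s n i) x"
      unfolding sum_ar1_coeff[OF that] D_def
      using sum_ar1_increments[where a = "\<lambda>j. Z (real j / real n) x"]
        \<open>s n i = _\<close> \<open>s n (i + k) = _\<close> by simp
    moreover have "exp (- 2 * \<theta> * (s n (i + k) - s n i)) = r ^ (2 * k)"
      unfolding s' using exp_r[of "2 * k"] by (simp add: algebra_simps)
    ultimately show ?thesis
      unfolding W2_def s' exp_r by (simp add: u_def right_diff_distrib)
  qed
  have inner: "{k. 1 \<le> k \<and> enat k \<le> min (max_lag w) (enat (n - i))} = {1..min K (n - i)}" for i
    by (auto simp: K)
  have "(\<Sum>i = 1..n - 1. \<Sum>k | 1 \<le> k \<and> enat k \<le> min (max_lag w) (enat (n - i)).
       w k * (W2 \<theta> \<sigma> Z (s n) i (i + k) x - 1)) =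
     (\<Sum>a\<in>?P. u a * (\<Sum>j = 2..n. ar1_coeff r a j * D j x)\<^sup>2) - (\<Sum>a\<in>?P. w (snd a))" for x
  proof -
    have "(\<Sum>i = 1..n - 1. \<Sum>k | 1 \<le> k \<and> enat k \<le> min (max_lag w) (enat (n - i)).
       w k * (W2 \<theta> \<sigma> Z (s n) i (i + k) x - 1)) =
      (\<Sum>(i, k)\<in>?P. w k * (W2 \<theta> \<sigma> Z (s n) i (i + k) x - 1))"
      unfolding inner lag_pairs_def by (rule sum.Sigma) auto
    also have "\<dots> = (\<Sum>a\<in>?P. u a * (\<Sum>j = 2..n. ar1_coeff r a j * D j x)\<^sup>2 - w (snd a))"
      by (intro sum.cong refl) (auto simp: W2)
    finally show ?thesis
      by (simp add: sum_subtractf)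
  qed
  then have "tau2 M \<theta> \<sigma> Z s w n = 1 / real n *
     variance (\<lambda>x. \<Sum>a\<in>?P. u a * (\<Sum>j = 2..n. ar1_coeff r a j * D j x)\<^sup>2)"
    unfolding tau2_def by (subst variance_quadratic_form_shift[symmetric, OF _ _ D_span,
        where c = "\<Sum>a\<in>lag_pairs n K. w (snd a)"]) simp_all
  also have "variance (\<lambda>x. \<Sum>a\<in>?P. u a * (\<Sum>j = 2..n. ar1_coeff r a j * D j x)\<^sup>2) =
    2 * (\<sigma>\<^sup>2 * (1 - r\<^sup>2))\<^sup>2 * (\<Sum>j = 2..n. \<Sum>l = 2..n.
      (\<Sum>a\<in>?P. u a * ar1_coeff r a j * ar1_coeff r a l)\<^sup>2)"
    using exp_gaussian_process_increments_orthogonal[OF Z _ _ r_def] D_span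
    by (intro variance_quadratic_form) (auto simp: D_def)
  \<comment> \<open>The increment variance moves inside the square; there its
    \<open>\<sigma>\<^sup>2\<close> cancels the one in \<open>u\<close>, and its
    \<open>1 - r\<^sup>2\<close> completes the normalising ratio of
    \<open>ar1_matrix\<close>.\<close>
  also have "\<dots> = 2 * (\<Sum>j = 2..n. \<Sum>l = 2..n.
      (\<sigma>\<^sup>2 * (1 - r\<^sup>2) * (\<Sum>a\<in>?P. u a * ar1_coeff r a j * ar1_coeff r a l))\<^sup>2)"
    unfolding power_mult_distrib by (simp add: sum_distrib_left mult.assoc)
  also have "(\<lambda>j l. \<sigma>\<^sup>2 * (1 - r\<^sup>2) * (\<Sum>a\<in>?P. u a * ar1_coeff r a j * ar1_coeff r a l)) =
      ar1_matrix n K r w"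
    using \<sigma> by (simp add: ar1_matrix_def u_def sum_distrib_left fun_eq_iff mult.assoc mult.left_commute)
  finally show ?thesis
    unfolding r_def by simp
qed

section \<open>The lower limit\<close>

text \<open>If \<open>w K\<close> were zero, every index in the supremum would be at most
  \<open>K - 1\<close>. The condition \<open>K \<ge> 1\<close> rules out the empty supremum, which
  is 0.\<close>

lemma max_lag_attained:
  assumes "max_lag w = enat K" and "K \<ge> 1"
  shows "w K \<noteq> 0"
proof
  assume "w K = 0"
  have "max_lag w \<le> enat (K - 1)"
    unfolding max_lag_def
  proof (rule SUP_least)
    fix k assume k: "k \<in> {k. 1 \<le> k \<and> w k \<noteq> 0}"
    then have "enat k \<le> max_lag w"
      unfolding max_lag_def by (rule SUP_upper)
    then show "enat k \<le> enat (K - 1)"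
      using assms k \<open>w K = 0\<close> by (cases "k = K") auto
  qed
  then show False
    using assms by simp
qed

theorem lemma5:
  fixes M :: "'a measure" and Z :: "real \<Rightarrow> 'a \<Rightarrow> real" and \<theta>\<^sub>0 \<sigma>\<^sub>0 :: real
    and s :: "nat \<Rightarrow> nat \<Rightarrow> real" and w :: "nat \<Rightarrow> real" and K :: nat
  assumes "\<theta>\<^sub>0 > 0" and "\<sigma>\<^sub>0\<^sup>2 > 0"
    and "exp_gaussian_process M \<theta>\<^sub>0 \<sigma>\<^sub>0 Z"
    and "\<And>n i. i \<in> {1..n} \<Longrightarrow> s n i = real i / real n"
    and "\<And>k. k \<ge> 1 \<Longrightarrow> w k \<ge> 0"
    and "\<exists>k\<ge>1. w k \<noteq> 0"
    and "max_lag w = enat K" and "K \<ge> 2"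
  shows "liminf (\<lambda>n. ereal (tau2 M \<theta>\<^sub>0 \<sigma>\<^sub>0 Z s w n)) > ereal (2 * (\<Sum>k = 1..K. w k)\<^sup>2)"
proof -
  define S where "S = (\<Sum>k = 1..K. w k)"
  \<comment> \<open>The lower bound for the superdiagonal entries; the exponential is
    \<open>r ^ (2 * n)\<close>, so \<open>c\<close> is free of \<open>n\<close>.\<close>
  define c where "c = w K / K * exp (- 2 * \<theta>\<^sub>0)"
  define f where "f = (\<lambda>n. 2 / real n *
    ((real (n - K) * S)\<^sup>2 / real (n - 1) + real (n - K) * c\<^sup>2))"
  have "w K > 0"
    using assms(5)[of K] max_lag_attained[OF assms(7)] assms(8) by force
  then have c: "c > 0"
    using assms(8) by (simp add: c_def)
  have "f n \<le> tau2 M \<theta>\<^sub>0 \<sigma>\<^sub>0 Z s w n" if n: "n > K" for n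
  proof -
    have "exp (- \<theta>\<^sub>0 / real n) ^ (2 * n) = exp (- 2 * \<theta>\<^sub>0)"
      using n by (simp flip: exp_of_nat_mult)
    then show ?thesis
      using ar1_matrix_frobenius_lower_bound[of "exp (- \<theta>\<^sub>0 / real n)" w K n] assms n
      unfolding f_def c_def S_def
      by (subst tau2_regular_grid[OF assms(3,1,2,4,7)]) (auto intro!: mult_left_mono divide_right_mono)
  qed
  then have "eventually (\<lambda>n. ereal (f n) \<le> ereal (tau2 M \<theta>\<^sub>0 \<sigma>\<^sub>0 Z s w n)) sequentially"
    by (intro eventually_sequentiallyI[of "Suc K"]) auto
  then have "liminf (\<lambda>n. ereal (f n)) \<le> liminf (\<lambda>n. ereal (tau2 M \<theta>\<^sub>0 \<sigma>\<^sub>0 Z s w n))"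
    by (rule Liminf_mono)
  moreover have "f \<longlonglongrightarrow> 2 * S\<^sup>2 + 2 * c\<^sup>2"
  \<comment> \<open>\<open>f\<close> contains truncated differences of naturals. For
    \<open>n > K + 1\<close> they agree with differences of reals, whose asymptotics
    \<open>real_asymp\<close> computes.\<close>
  proof (rule Lim_transform_eventually)
    show "(\<lambda>n. 2 * ((real n - real K)\<^sup>2 / (real n * (real n - 1))) * S\<^sup>2 +
      2 * ((real n - real K) / real n) * c\<^sup>2) \<longlonglongrightarrow> 2 * S\<^sup>2 + 2 * c\<^sup>2"
      by real_asymp
    show "\<forall>\<^sub>F n in sequentially. 2 * ((real n - real K)\<^sup>2 / (real n * (real n - 1))) * S\<^sup>2 +
      2 * ((real n - real K) / real n) * c\<^sup>2 = f n"
      using eventually_gt_at_top[of "K + 1"]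
      by eventually_elim (simp add: f_def of_nat_diff power_mult_distrib distrib_left mult.assoc
          left_diff_distrib right_diff_distrib diff_divide_distrib)
  qed
  then have "liminf (\<lambda>n. ereal (f n)) = ereal (2 * S\<^sup>2 + 2 * c\<^sup>2)"
    by (intro lim_imp_Liminf) auto
  moreover have "ereal (2 * S\<^sup>2) < ereal (2 * S\<^sup>2 + 2 * c\<^sup>2)"
    using c by simp
  ultimately show ?thesis
    unfolding S_def by (metis less_le_trans)
qed

end
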